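(* Let $f=\sum_{\alpha\in\mathbb Z_+(\infty)}\hat f(\alpha)\zeta^\alpha$, $f\neq0$, be a power series with complex coefficients satisfying the free term domination condition $$|\hat f(0)|\ \ge\sum_{\alpha\in\mathbb Z_+(\infty),\,\alpha\ne0}|\hat f(\alpha)|.$$ Then $f$ is $D_n$-$\sigma(X,X')$-cyclic in every ISL $X$ which contains $\ell^1(\mathbb Z_+(\infty))$ and for which the finitely supported sequences are norm dense in $X'$; moreover $f$ is $D_n$-$\sigma(\ell^1,c_0)$-cyclic in $\ell^1$ itself. In particular, the conclusion holds for every nonzero polynomial $f$ with dominating free term.
   Context: An ISL (invariant sequence lattice) is a Banach space $X$ of complex sequences $x=(x_n)_{n\ge1}$ such that: (i) if $x\in X$ and $|y_n|\le|x_n|$ for all $n$, then $y\in X$ and $\|y\|_X\le\|x\|_X$; (ii) for every $n\ge1$ the dilation $D_n\big(\sum_kx_k\delta_k\big)=\sum_kx_k\delta_{nk}$ maps $X$ into $X$; (iii) $\delta_1\in X$ ($\delta_k$ the standard unit vectors). $X'=\{y:\sum_n|x_ny_n|<\infty\ \forall x\in X\}$ with the dual norm $\|y\|=\sup\{|\langle x,y\rangle|:\|x\|_X\le1\}$, $\langle x,y\rangle=\sum_nx_ny_n$; $\sigma(X,X')$ is the corresponding weak topology on $X$, and $\sigma(\ell^1,c_0)$ is the weak-* topology of $\ell^1=(c_0)^*$. $\mathbb Z_+(\infty)$ is the set of finitely supported sequences $\alpha=(\alpha_1,\alpha_2,\dots)$ of nonnegative integers, identified with $\mathbb N$ through $n=\prod_jp_j^{\alpha_j}\leftrightarrow\alpha=\alpha(n)$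 ($p_1=2,p_2=3,\dots$ the primes). A sequence $x$ is identified with the power series $Bx=\sum_nx_n\zeta^{\alpha(n)}$ in the variables $\zeta=(\zeta_1,\zeta_2,\dots)$, $\zeta^\alpha=\prod_j\zeta_j^{\alpha_j}$; $D_n$ then becomes multiplication by $\zeta^{\alpha(n)}$. The element $f$ is $D_n$-cyclic for a given topology if the linear span of $\{D_nf:n\ge1\}$ (equivalently, the set of all products $pf$, $p$ a polynomial in finitely many of the variables) is dense in the space for that topology. *)

theory Defs
  imports
    "HOL-Analysis.Analysis"
    "HOL-Computational_Algebra.Computational_Algebra"
    "HOL-Library.Function_Algebras"
    "HOL-Library.Poly_Mapping"
begin

text \<open>
  A complex sequence \<open>(x\<^sub>n)\<close> with \<open>n \<ge> 1\<close> is a function \<open>x :: nat \<Rightarrow> complex\<close> with \<open>x 0 = 0\<close>.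
  All spaces of sequences below consist of such functions only, so that the value at the
  index \<open>0\<close> carries no information.
\<close>

global_interpretation seq: vector_space "\<lambda>(c::complex) (x :: nat \<Rightarrow> complex). (\<lambda>n. c * x n)"
  by unfold_locales (auto simp: algebra_simps fun_eq_iff)

definition unit_seq :: "nat \<Rightarrow> nat \<Rightarrow> complex" where
  "unit_seq k = (\<lambda>n. if n = k then 1 else 0)"

definition dilation :: "nat \<Rightarrow> (nat \<Rightarrow> complex) \<Rightarrow> nat \<Rightarrow> complex" where
  "dilation n x = (\<lambda>k. if n dvd k then x (k div n) else 0)"

lemma dilation_unit_seq: "n \<ge> 1 \<Longrightarrow> dilation n (unit_seq k) = unit_seq (n * k)"
  by (auto simp: dilation_def unit_seq_def fun_eq_iff)

text \<open>The norm is a function on all sequences, of which only the values on \<open>X\<close> matter.\<close>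

locale banach_sequence_space =
  fixes X :: "(nat \<Rightarrow> complex) set" and N :: "(nat \<Rightarrow> complex) \<Rightarrow> real"
  assumes index_zero: "x \<in> X \<Longrightarrow> x 0 = 0"
    and subspace: "seq.subspace X"
    and norm_nonneg: "x \<in> X \<Longrightarrow> N x \<ge> 0"
    and norm_eq_zero: "x \<in> X \<Longrightarrow> N x = 0 \<longleftrightarrow> x = 0"
    and norm_scale: "x \<in> X \<Longrightarrow> N (\<lambda>n. c * x n) = cmod c * N x"
    and norm_triangle: "x \<in> X \<Longrightarrow> y \<in> X \<Longrightarrow> N (x + y) \<le> N x + N y"
    and complete: "(\<And>i. u i \<in> X) \<Longrightarrow>
      (\<And>e. e > 0 \<Longrightarrow> \<exists>M. \<forall>i\<ge>M. \<forall>j\<ge>M. N (u i - u j) < e) \<Longrightarrow>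
      \<exists>x\<in>X. (\<lambda>i. N (u i - x)) \<longlonglongrightarrow> 0"

locale invariant_sequence_lattice = banach_sequence_space +
  assumes solid: "x \<in> X \<Longrightarrow> y 0 = 0 \<Longrightarrow> (\<And>n. cmod (y n) \<le> cmod (x n)) \<Longrightarrow> y \<in> X \<and> N y \<le> N x"
    and dilation_closed: "n \<ge> 1 \<Longrightarrow> x \<in> X \<Longrightarrow> dilation n x \<in> X"
    and unit_seq_1: "unit_seq 1 \<in> X"

definition pairing :: "(nat \<Rightarrow> complex) \<Rightarrow> (nat \<Rightarrow> complex) \<Rightarrow> complex" where
  "pairing x y = suminf (\<lambda>n. x n * y n)"

definition dual_space :: "(nat \<Rightarrow> complex) set \<Rightarrow> (nat \<Rightarrow> complex) set" where
  "dual_space X = {y. y 0 = 0 \<and> (\<forall>x\<in>X. summable (\<lambda>n. cmod (x n * y n)))}"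

text \<open>
  For a Banach sequence lattice \<open>X\<close> and \<open>y \<in> dual_space X\<close> the supremum is finite by the
  closed graph theorem, so the real-valued supremum is the genuine one.
\<close>

definition dual_norm ::
  "(nat \<Rightarrow> complex) set \<Rightarrow> ((nat \<Rightarrow> complex) \<Rightarrow> real) \<Rightarrow> (nat \<Rightarrow> complex) \<Rightarrow> real" where
  "dual_norm X N y = (SUP x\<in>{x\<in>X. N x \<le> 1}. cmod (pairing x y))"

definition finitely_supported_dense ::
  "(nat \<Rightarrow> complex) set \<Rightarrow> ((nat \<Rightarrow> complex) \<Rightarrow> real) \<Rightarrow> bool" where
  "finitely_supported_dense Y M \<longleftrightarrow>
     (\<forall>y\<in>Y. \<forall>e>0. \<exists>z\<in>Y. finite {n. z n \<noteq> 0} \<and> M (y - z) < e)"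

text \<open>
  The topology \<open>\<sigma>(X,Y)\<close>: the coarsest topology on \<open>X\<close> for which all functionals
  \<open>pairing _ y\<close> with \<open>y \<in> Y\<close> are continuous.
\<close>

definition weak_topology ::
  "(nat \<Rightarrow> complex) set \<Rightarrow> (nat \<Rightarrow> complex) set \<Rightarrow> (nat \<Rightarrow> complex) topology" where
  "weak_topology X Y =
     topology_generated_by {{x\<in>X. pairing x y \<in> U} |y U. y \<in> Y \<and> open U}"

lemma topspace_weak_topology:
  assumes "Y \<noteq> {}"
  shows "topspace (weak_topology X Y) = X"
proof -
  from assms obtain y where "y \<in> Y" by auto
  hence "X \<in> {{x\<in>X. pairing x y \<in> U} |y U. y \<in> Y \<and> open U}"
    by (auto intro!: exI[of _ y] exI[of _ UNIV])
  thus ?thesis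
    unfolding weak_topology_def topology_generated_by_topspace by blast
qed

definition ell1 :: "(nat \<Rightarrow> complex) set" where
  "ell1 = {x. x 0 = 0 \<and> summable (\<lambda>n. cmod (x n))}"

definition czero :: "(nat \<Rightarrow> complex) set" where
  "czero = {y. y 0 = 0 \<and> y \<longlonglongrightarrow> 0}"

definition dilation_cyclic :: "(nat \<Rightarrow> complex) topology \<Rightarrow> (nat \<Rightarrow> complex) \<Rightarrow> bool" where
  "dilation_cyclic T x \<longleftrightarrow>
     x \<in> topspace T \<and> T closure_of (seq.span {dilation n x |n. n \<ge> 1}) = topspace T"

text \<open>
  Multi-indices are finitely supported functions \<open>nat \<Rightarrow>\<^sub>0 nat\<close> and formal power series in
  countably many variables are their coefficient functions \<open>(nat \<Rightarrow>\<^sub>0 nat) \<Rightarrow> complex\<close>.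
  Variables and primes are numbered from \<open>0\<close>, so \<open>nth_prime 0 = 2\<close>.
\<close>

definition nth_prime :: "nat \<Rightarrow> nat" where
  "nth_prime j = enumerate {p. prime p} j"

definition index_nat :: "(nat \<Rightarrow>\<^sub>0 nat) \<Rightarrow> nat" where
  "index_nat \<alpha> = (\<Prod>j\<in>Poly_Mapping.keys \<alpha>. nth_prime j ^ Poly_Mapping.lookup \<alpha> j)"

lemma bij_betw_nth_prime: "bij_betw nth_prime UNIV {p. prime p}"
  unfolding nth_prime_def using bij_enumerate[OF primes_infinite] by simp

lemma prime_nth_prime [simp]: "prime (nth_prime j)"
  using bij_betw_nth_prime by (auto simp: bij_betw_def)

lemma inj_nth_prime: "inj nth_prime"
  using bij_betw_nth_prime by (auto simp: bij_betw_def)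

lemma multiplicity_index_nat: "multiplicity (nth_prime j) (index_nat \<alpha>) = Poly_Mapping.lookup \<alpha> j"
proof -
  let ?A = "nth_prime ` Poly_Mapping.keys \<alpha>"
  have "index_nat \<alpha> = (\<Prod>p\<in>?A. p ^ Poly_Mapping.lookup \<alpha> (inv nth_prime p))"
    by (simp add: index_nat_def prod.reindex inj_on_subset[OF inj_nth_prime] inj_nth_prime)
  hence "multiplicity (nth_prime j) (index_nat \<alpha>) =
      (if nth_prime j \<in> ?A then Poly_Mapping.lookup \<alpha> (inv nth_prime (nth_prime j)) else 0)"
    by (simp only:) (intro multiplicity_prod_prime_powers, auto)
  thus ?thesis
    using inj_nth_prime by (auto simp: inj_eq in_keys_iff)
qed

lemma bij_betw_index_nat: "bij_betw index_nat UNIV {1..}"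
proof (rule bij_betw_imageI)
  show "inj index_nat"
    by (rule injI, rule poly_mapping_eqI) (metis multiplicity_index_nat)
  show "range index_nat = {1..}"
  proof (intro equalityI subsetI)
    fix n assume "n \<in> range index_nat"
    thus "n \<in> {1..}"
      by (auto simp: index_nat_def Suc_le_eq prime_gt_0_nat intro!: prod_pos)
  next
    fix n :: nat assume n: "n \<in> {1..}"
    define g where "g = (\<lambda>j. multiplicity (nth_prime j) n)"
    have "{j. g j \<noteq> 0} \<subseteq> nth_prime -` prime_factors n"
      using n by (auto simp: g_def prime_factors_multiplicity)
    hence fin: "finite {j. g j \<noteq> 0}"
      by (rule finite_subset) (intro finite_vimageI inj_nth_prime finite_set_mset)
    hence lookup: "Poly_Mapping.lookup (Abs_poly_mapping g) = g"
      by simp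
    have pos: "index_nat (Abs_poly_mapping g) \<noteq> 0"
      using prime_gt_0_nat[OF prime_nth_prime] by (auto simp: index_nat_def)
    have "index_nat (Abs_poly_mapping g) = n"
    proof (rule multiplicity_eq_nat)
      fix p :: nat assume "prime p"
      then obtain j where p: "p = nth_prime j"
        using bij_betw_nth_prime by (auto simp: bij_betw_def)
      show "multiplicity p (index_nat (Abs_poly_mapping g)) = multiplicity p n"
        unfolding p multiplicity_index_nat lookup by (simp add: g_def)
    qed (use pos n in auto)
    thus "n \<in> range index_nat" by (metis rangeI)
  qed
qed

definition coeff_seq :: "((nat \<Rightarrow>\<^sub>0 nat) \<Rightarrow> complex) \<Rightarrow> nat \<Rightarrow> complex" where
  "coeff_seq f n = (if n = 0 then 0 else f (inv index_nat n))"

lemma coeff_seq_index_nat: "coeff_seq f (index_nat \<alpha>) = f \<alpha>"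
proof -
  have "index_nat \<alpha> \<in> {1..}" and "inj index_nat"
    using bij_betw_index_nat by (auto simp: bij_betw_def)
  thus ?thesis by (auto simp: coeff_seq_def)
qed

definition free_term_dominates :: "((nat \<Rightarrow>\<^sub>0 nat) \<Rightarrow> complex) \<Rightarrow> bool" where
  "free_term_dominates f \<longleftrightarrow>
     (\<lambda>\<alpha>. cmod (f \<alpha>)) summable_on {\<alpha>. \<alpha> \<noteq> 0} \<and>
     cmod (f 0) \<ge> (\<Sum>\<^sub>\<infinity>\<alpha>\<in>{\<alpha>. \<alpha> \<noteq> 0}. cmod (f \<alpha>))"

end

theory Submission
  imports Defs
begin

text \<open>
  By finite-dimensional linear algebra a subspace \<open>S\<close> of \<open>X\<close> is \<open>\<sigma>(X,Y)\<close>-dense as soon as no nonzero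
  \<open>y \<in> Y\<close> annihilates it. If \<open>y \<in> c\<^sub>0\<close> annihilates all dilations of \<open>a\<close>, then
  \<open>a\<^sub>1 y\<^sub>n = - (\<Sum>k\<ge>2. a\<^sub>k y\<^sub>n\<^sub>k)\<close> for all \<open>n\<close>. For \<open>y \<noteq> 0\<close> let \<open>n\<close> be the largest index at which
  \<open>\<bar>y\<bar>\<close> attains its maximum: then \<open>\<bar>y\<^sub>n\<^sub>k\<bar> < \<bar>y\<^sub>n\<bar>\<close> for all \<open>k \<ge> 2\<close>, which contradicts
  \<open>\<bar>a\<^sub>1\<bar> \<ge> (\<Sum>k\<ge>2. \<bar>a\<^sub>k\<bar>)\<close>. It remains to see that \<open>X' \<subseteq> c\<^sub>0\<close>: two gliding hump arguments show that
  the unit vectors are bounded in \<open>X\<close> and that the dual norm is finite, so the dual norm dominates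
  the sup norm and \<open>X'\<close> is contained in the uniform closure of the finitely supported sequences.
\<close>

section \<open>Density in weak topologies\<close>

text \<open>Induction on \<open>I\<close>: the kernel of \<open>\<phi> i\<close> in \<open>S\<close>
  has codimension at most one, so a representation of \<open>g\<close> on that kernel extends to
  \<open>S\<close> once a suitable multiple of \<open>\<phi> i\<close> is added. Linearity is
  required on \<open>S\<close> alone because pairings are linear only where their series
  converge.\<close>

lemma functional_eq_sum_of_kernels:
  fixes \<phi> :: "'i \<Rightarrow> (nat \<Rightarrow> complex) \<Rightarrow> complex"
  assumes "finite I" "seq.subspace S"
    and "\<And>s t. s \<in> S \<Longrightarrow> t \<in> S \<Longrightarrow> g (s + t) = g s + g t"
    and "\<And>c s. s \<in> S \<Longrightarrow> g (\<lambda>n. c * s n) = c * g s"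
    and "\<And>i s t. i \<in> I \<Longrightarrow> s \<in> S \<Longrightarrow> t \<in> S \<Longrightarrow> \<phi> i (s + t) = \<phi> i s + \<phi> i t"
    and "\<And>i c s. i \<in> I \<Longrightarrow> s \<in> S \<Longrightarrow> \<phi> i (\<lambda>n. c * s n) = c * \<phi> i s"
    and "\<And>s. s \<in> S \<Longrightarrow> (\<And>i. i \<in> I \<Longrightarrow> \<phi> i s = 0) \<Longrightarrow> g s = 0"
  shows "\<exists>c. \<forall>s\<in>S. g s = (\<Sum>i\<in>I. c i * \<phi> i s)"
  using assms
proof (induction I arbitrary: S rule: finite_induct)
  case empty
  thus ?case by auto
next
  case (insert i I)
  have gadd: "g (s + t) = g s + g t" if "s \<in> S" "t \<in> S" for s t
    by (rule insert.prems(2)[OF that])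
  have padd: "\<phi> j (s + t) = \<phi> j s + \<phi> j t" if "j \<in> insert i I" "s \<in> S" "t \<in> S" for j s t
    by (rule insert.prems(4)[OF that])
  note gmul = insert.prems(3) and pmul = insert.prems(5)
  let ?S = "{s\<in>S. \<phi> i s = 0}"
  have "\<phi> i (0::nat \<Rightarrow> complex) = 0"
    using pmul[of i 0 0] seq.subspace_0[OF insert.prems(1)] by (simp add: zero_fun_def)
  moreover have "\<phi> i (s + t) = 0" if "s \<in> ?S" "t \<in> ?S" for s t
    using padd[of i s t] that by simp
  moreover have "\<phi> i (\<lambda>n. c * s n) = 0" if "s \<in> ?S" for s c
    using pmul[of i s c] that by auto
  ultimately have sub: "seq.subspace ?S"
    using insert.prems(1) unfolding seq.subspace_def by blast
  have "\<exists>c. \<forall>s\<in>?S. g s = (\<Sum>i\<in>I. c i * \<phi> i s)"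
    by (rule insert.IH[OF sub]) (auto simp del: plus_fun_apply intro: gadd gmul padd pmul insert.prems(6))
  then obtain c where c: "\<And>s. s \<in> S \<Longrightarrow> \<phi> i s = 0 \<Longrightarrow> g s = (\<Sum>i\<in>I. c i * \<phi> i s)"
    by auto
  show ?case
  proof (cases "\<exists>e\<in>S. \<phi> i e \<noteq> 0")
    case False
    \<comment> \<open>Here \<open>\<phi> i\<close> vanishes on all of \<open>S\<close>, so its
      coefficient is irrelevant.\<close>
    thus ?thesis using c insert.hyps by (auto intro!: exI[of _ c])
  next
    case True
    then obtain e where e: "e \<in> S" "\<phi> i e \<noteq> 0" by auto
    \<comment> \<open>The coefficient of \<open>\<phi> i\<close> is forced by evaluating the desired
      identity at \<open>e\<close>.\<close>
    define d where "d = (g e - (\<Sum>j\<in>I. c j * \<phi> j e)) / \<phi> i e"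
    have "g s = (\<Sum>j\<in>insert i I. (c(i := d)) j * \<phi> j s)" if s: "s \<in> S" for s
    proof -
      \<comment> \<open>This multiple of \<open>e\<close> moves \<open>s\<close> into the kernel of
        \<open>\<phi> i\<close>, where \<open>c\<close> is available.\<close>
      define l where "l = - (\<phi> i s / \<phi> i e)"
      have le: "(\<lambda>n. l * e n) \<in> S"
        using seq.subspace_scale[OF insert.prems(1) e(1)] by simp
      define t where "t = s + (\<lambda>n. l * e n)"
      have t: "t \<in> S" using seq.subspace_add[OF insert.prems(1) s le] by (simp add: t_def)
      have pt: "\<phi> j t = \<phi> j s + l * \<phi> j e" if "j \<in> insert i I" for j
        using padd[OF that s le] pmul[OF that e(1)] by (simp add: t_def)
      have "\<phi> i t = 0" using pt[of i] e(2) by (simp add: l_def)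
      hence "g t = (\<Sum>j\<in>I. c j * \<phi> j t)" by (rule c[OF t])
      also have "\<dots> = (\<Sum>j\<in>I. c j * \<phi> j s) + l * (\<Sum>j\<in>I. c j * \<phi> j e)"
        by (simp add: pt algebra_simps sum.distrib sum_distrib_left)
      finally have "g s + l * g e = \<dots>" using gadd[OF s le] gmul[OF e(1)] by (simp add: t_def)
      hence "g s = (\<Sum>j\<in>I. c j * \<phi> j s) - l * (g e - (\<Sum>j\<in>I. c j * \<phi> j e))"
        by (simp add: algebra_simps)
      also have "\<dots> = (\<Sum>j\<in>I. c j * \<phi> j s) + d * \<phi> i s"
        using e(2) by (simp add: l_def d_def)
      also have "(\<Sum>j\<in>I. c j * \<phi> j s) = (\<Sum>j\<in>I. (c(i := d)) j * \<phi> j s)"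
        using insert.hyps by (intro sum.cong) auto
      finally show ?thesis using insert.hyps by simp
    qed
    thus ?thesis by blast
  qed
qed

section \<open>Bilinearity of the pairing\<close>

lemma dual_space_summable:
  assumes "y \<in> dual_space X" "x \<in> X"
  shows "summable (\<lambda>n. cmod (x n * y n))" "summable (\<lambda>n. x n * y n)"
  using assms summable_norm_cancel[of "\<lambda>n. x n * y n"] by (auto simp: dual_space_def)

lemma pairing_add_left:
  assumes "y \<in> dual_space X" "x \<in> X" "x' \<in> X"
  shows "pairing (x + x') y = pairing x y + pairing x' y"
  using suminf_add[OF dual_space_summable(2)[OF assms(1,2)] dual_space_summable(2)[OF assms(1,3)]]
  by (simp add: pairing_def algebra_simps)

lemma pairing_scale_left:
  assumes "y \<in> dual_space X" "x \<in> X"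
  shows "pairing (\<lambda>n. c * x n) y = c * pairing x y"
  using suminf_mult[OF dual_space_summable(2)[OF assms], of c]
  by (simp add: pairing_def algebra_simps)

lemma pairing_add_right:
  assumes "y \<in> dual_space X" "y' \<in> dual_space X" "x \<in> X"
  shows "pairing x (y + y') = pairing x y + pairing x y'"
  using suminf_add[OF dual_space_summable(2)[OF assms(1,3)] dual_space_summable(2)[OF assms(2,3)]]
  by (simp add: pairing_def algebra_simps)

lemma pairing_scale_right:
  assumes "y \<in> dual_space X" "x \<in> X"
  shows "pairing x (\<lambda>n. c * y n) = c * pairing x y"
  using suminf_mult[OF dual_space_summable(2)[OF assms], of c]
  by (simp add: pairing_def algebra_simps)

lemma subspace_dual_space: "seq.subspace (dual_space X)"
proof -
  have "summable (\<lambda>n. cmod (x n * (y n + y' n)))"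
    if "y \<in> dual_space X" "y' \<in> dual_space X" "x \<in> X" for x y y'
    by (rule summable_comparison_test'[OF summable_add
          [OF dual_space_summable(1)[OF that(1,3)] dual_space_summable(1)[OF that(2,3)]]])
      (simp add: distrib_left norm_triangle_ineq)
  moreover have "summable (\<lambda>n. cmod (x n * (c * y n)))" if "y \<in> dual_space X" "x \<in> X" for x y c
    using summable_mult[OF dual_space_summable(1)[OF that], of "cmod c"]
    by (simp add: norm_mult algebra_simps)
  ultimately show ?thesis
    by (auto simp: seq.subspace_def dual_space_def)
qed

text \<open>Induction on \<open>F\<close>. If some \<open>t\<close> in \<open>S\<close> is killed by
  \<open>F\<close> but not by the new \<open>y\<close>, adding a multiple of \<open>t\<close>
  corrects the value at \<open>y\<close> and leaves those at \<open>F\<close> alone. Otherwise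
  \<open>y\<close> agrees on \<open>S\<close> with a combination of \<open>F\<close>; by
  \<open>ann\<close> it equals that combination, and interpolation at \<open>F\<close> already
  settles \<open>y\<close>.\<close>

lemma pairing_interpolation:
  assumes X: "seq.subspace X" and S: "seq.subspace S" "S \<subseteq> X"
    and Y: "seq.subspace Y" "Y \<subseteq> dual_space X"
    and ann: "\<And>y. y \<in> Y \<Longrightarrow> (\<And>s. s \<in> S \<Longrightarrow> pairing s y = 0) \<Longrightarrow> y = 0"
    and F: "finite F" "F \<subseteq> Y" and x: "x \<in> X"
  shows "\<exists>s\<in>S. \<forall>y\<in>F. pairing s y = pairing x y"
  using F
proof (induction F rule: finite_induct)
  case empty
  show ?case using seq.subspace_0[OF S(1)] by auto
next
  case (insert y F)
  then obtain s where s: "s \<in> S" "\<And>y. y \<in> F \<Longrightarrow> pairing s y = pairing x y" by auto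
  have dual: "z \<in> dual_space X" if "z \<in> insert y F" for z
    using that insert.prems Y(2) by auto
  have SX: "t \<in> X" if "t \<in> S" for t using that S(2) by auto
  show ?case
  proof (cases "\<exists>t\<in>S. (\<forall>z\<in>F. pairing t z = 0) \<and> pairing t y \<noteq> 0")
    case True
    then obtain t where t: "t \<in> S" "\<And>z. z \<in> F \<Longrightarrow> pairing t z = 0" "pairing t y \<noteq> 0" by auto
    define c where "c = (pairing x y - pairing s y) / pairing t y"
    have ct: "(\<lambda>n. c * t n) \<in> S" using seq.subspace_scale[OF S(1) t(1)] by simp
    have "pairing (s + (\<lambda>n. c * t n)) z = pairing s z + c * pairing t z" if "z \<in> insert y F" for z
      using pairing_add_left[OF dual[OF that] SX[OF s(1)] SX[OF ct]]
        pairing_scale_left[OF dual[OF that] SX[OF t(1)]] by simp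
    hence "\<forall>z\<in>insert y F. pairing (s + (\<lambda>n. c * t n)) z = pairing x z"
      using s(2) t(2,3) by (auto simp: c_def)
    thus ?thesis using seq.subspace_add[OF S(1) s(1) ct] by blast
  next
    case False
    have "\<exists>c. \<forall>s\<in>S. pairing s y = (\<Sum>z\<in>F. c z * pairing s z)"
      by (rule functional_eq_sum_of_kernels[OF insert.hyps(1) S(1)])
        (use False in \<open>auto intro!: pairing_add_left pairing_scale_left dual SX\<close>)
    then obtain c where c: "\<And>s. s \<in> S \<Longrightarrow> pairing s y = (\<Sum>z\<in>F. c z * pairing s z)" by blast
    define w where "w = (\<Sum>z\<in>F. (\<lambda>n. c z * z n))"
    have pw: "w \<in> Y \<and> (\<forall>u\<in>X. pairing u w = (\<Sum>z\<in>F. c z * pairing u z))"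
      unfolding w_def using \<open>finite F\<close> insert.prems
    proof (induction F rule: finite_induct)
      case empty
      show ?case using seq.subspace_0[OF Y(1)] by (simp add: pairing_def zero_fun_def)
    next
      case (insert z F)
      have z: "(\<lambda>n. c z * z n) \<in> Y" using seq.subspace_scale[OF Y(1)] insert.prems by simp
      have "pairing u ((\<lambda>n. c z * z n) + (\<Sum>z\<in>F. (\<lambda>n. c z * z n)))
        = c z * pairing u z + (\<Sum>z\<in>F. c z * pairing u z)" if "u \<in> X" for u
        using pairing_add_right[of "\<lambda>n. c z * z n" X "\<Sum>z\<in>F. (\<lambda>n. c z * z n)" u]
          pairing_scale_right[of z X u "c z"] insert z that subsetD[OF Y(2)] by auto
      moreover have "(\<lambda>n. c z * z n) + (\<Sum>z\<in>F. (\<lambda>n. c z * z n)) \<in> Y"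
        using seq.subspace_add[OF Y(1) z] insert by simp
      ultimately show ?case using insert.hyps by (simp add: plus_fun_def)
    qed
    have mw: "(\<lambda>n. (-1) * w n) \<in> Y" using seq.subspace_scale[OF Y(1), of w "-1"] pw by simp
    \<comment> \<open>The difference \<open>y - w\<close> lies in \<open>Y\<close> and annihilates
      \<open>S\<close>.\<close>
    have "y + (\<lambda>n. (-1) * w n) = 0"
    proof (rule ann)
      show "y + (\<lambda>n. (-1) * w n) \<in> Y" using seq.subspace_add[OF Y(1) _ mw] insert.prems by simp
      fix s assume "s \<in> S"
      thus "pairing s (y + (\<lambda>n. (-1) * w n)) = 0"
        using pairing_add_right[of y X "\<lambda>n. (-1) * w n" s] pairing_scale_right[of w X s "-1"]
          pw mw insert.prems subsetD[OF Y(2)] SX[of s] c[of s] by auto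
    qed
    hence "y = w" by (auto simp: fun_eq_iff)
    hence "pairing s y = pairing x y" using pw s x SX by simp
    thus ?thesis using s by auto
  qed
qed

text \<open>A subbasic set constrains a single functional, a binary intersection merges two finite
  sets of functionals, and a union inherits one from a member. Exact agreement on \<open>F\<close>
  replaces the usual epsilon condition, since interpolation below is exact.\<close>

lemma openin_weak_topologyD:
  assumes "openin (weak_topology X Y) W" "x \<in> W"
  shows "\<exists>F. finite F \<and> F \<subseteq> Y \<and> (\<forall>u\<in>X. (\<forall>y\<in>F. pairing u y = pairing x y) \<longrightarrow> u \<in> W)"
proof -
  have "generate_topology_on {{x\<in>X. pairing x y \<in> U} |y U. y \<in> Y \<and> open U} W"
    using assms(1) by (simp add: weak_topology_def openin_topology_generated_by_iff)
  thus ?thesis using assms(2)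
  proof induction
    case Empty
    thus ?case by simp
  next
    case (Int A B)
    from Int obtain F G where
      "finite F" "F \<subseteq> Y" "\<forall>u\<in>X. (\<forall>y\<in>F. pairing u y = pairing x y) \<longrightarrow> u \<in> A"
      "finite G" "G \<subseteq> Y" "\<forall>u\<in>X. (\<forall>y\<in>G. pairing u y = pairing x y) \<longrightarrow> u \<in> B"
      by blast
    thus ?case by (intro exI[of _ "F \<union> G"]) auto
  next
    case (UN K)
    then obtain k where "k \<in> K" "x \<in> k" by blast
    with UN.IH[OF this] show ?case by (meson UnionI)
  next
    case (Basis B)
    then obtain y U where "B = {x\<in>X. pairing x y \<in> U}" "y \<in> Y" by auto
    thus ?case using Basis by (intro exI[of _ "{y}"]) auto
  qed
qed

lemma weak_topology_closure_of_subspace: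
  assumes "seq.subspace X" "seq.subspace S" "S \<subseteq> X" "seq.subspace Y" "Y \<subseteq> dual_space X"
    and "\<And>y. y \<in> Y \<Longrightarrow> (\<And>s. s \<in> S \<Longrightarrow> pairing s y = 0) \<Longrightarrow> y = 0"
  shows "weak_topology X Y closure_of S = X"
proof -
  have top: "topspace (weak_topology X Y) = X"
    using seq.subspace_0[OF assms(4)] by (intro topspace_weak_topology) auto
  have "\<exists>s\<in>S. s \<in> W" if x: "x \<in> X" and W: "x \<in> W" "openin (weak_topology X Y) W" for x W
  proof -
    obtain F where F: "finite F" "F \<subseteq> Y"
      "\<forall>u\<in>X. (\<forall>y\<in>F. pairing u y = pairing x y) \<longrightarrow> u \<in> W"
      using openin_weak_topologyD[OF W(2,1)] by (elim exE conjE)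
    have "\<exists>s\<in>S. \<forall>y\<in>F. pairing s y = pairing x y"
      by (rule pairing_interpolation[OF assms(1-5) _ F(1,2) x]) (erule assms(6), simp)
    then obtain s where s: "s \<in> S" "\<forall>y\<in>F. pairing s y = pairing x y" by auto
    have "s \<in> X" using s(1) assms(3) by (rule set_rev_mp)
    hence "s \<in> W" using bspec[OF F(3)] s(2) by simp
    thus ?thesis using s(1) by (rule bexI)
  qed
  thus ?thesis by (auto simp: closure_of_def top)
qed

section \<open>Annihilators of dilation invariant subspaces\<close>

text \<open>\<open>dilation n a\<close> is supported on the multiples of \<open>n\<close>, so the
  series can be reindexed along \<open>k \<mapsto> n * k\<close>, which is strictly increasing
  because \<open>n \<ge> 1\<close>.\<close>

lemma pairing_dilation:
  assumes "n \<ge> 1"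
  shows "pairing (dilation n a) y = suminf (\<lambda>k. a k * y (n * k))"
proof -
  have "suminf (\<lambda>k. dilation n a (n * k) * y (n * k)) = pairing (dilation n a) y"
    unfolding pairing_def using assms
    by (intro suminf_mono_reindex) (auto simp: strict_mono_def dilation_def image_iff dvd_def)
  thus ?thesis using assms by (simp add: dilation_def)
qed

section \<open>The sequence spaces \<open>czero\<close> and \<open>ell1\<close>\<close>

lemma czero_bounded:
  assumes "y \<in> czero"
  obtains B where "\<And>n. cmod (y n) \<le> B"
proof -
  have "convergent y" using assms by (auto simp: czero_def convergent_def)
  thus ?thesis using that by (meson BseqE convergent_imp_Bseq)
qed

lemma subspace_czero: "seq.subspace czero"
  using tendsto_add[of _ "0::complex" sequentially _ 0] tendsto_mult_right_zero[of _ sequentially]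
  by (fastforce simp: seq.subspace_def czero_def zero_fun_def plus_fun_def)

lemma czero_subset_dual_space_ell1: "czero \<subseteq> dual_space ell1"
proof
  fix y assume y: "y \<in> czero"
  obtain B where B: "\<And>n. cmod (y n) \<le> B" using czero_bounded[OF y] by blast
  have "summable (\<lambda>n. cmod (x n * y n))" if "x \<in> ell1" for x
  proof (rule summable_comparison_test')
    show "summable (\<lambda>n. cmod (x n) * B)" using that by (intro summable_mult2) (simp add: ell1_def)
    show "norm (cmod (x n * y n)) \<le> cmod (x n) * B" for n
      using B[of n] by (simp add: norm_mult mult_left_mono)
  qed
  thus "y \<in> dual_space ell1" using y by (simp add: dual_space_def czero_def)
qed

lemma subspace_ell1: "seq.subspace ell1"
proof -
  have "summable (\<lambda>n. cmod (x n + y n))"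
    if "summable (\<lambda>n. cmod (x n))" "summable (\<lambda>n. cmod (y n))" for x y :: "nat \<Rightarrow> complex"
    by (rule summable_comparison_test'[OF summable_add[OF that]]) (simp add: norm_triangle_ineq)
  thus ?thesis by (auto simp: seq.subspace_def ell1_def norm_mult intro: summable_mult)
qed

lemma dilation_ell1:
  assumes "n \<ge> 1" "x \<in> ell1"
  shows "dilation n x \<in> ell1"
proof -
  have "summable (\<lambda>k. cmod (dilation n x (n * k))) \<longleftrightarrow> summable (\<lambda>k. cmod (dilation n x k))"
    using assms(1)
    by (intro summable_mono_reindex) (auto simp: strict_mono_def dilation_def image_iff dvd_def)
  thus ?thesis using assms by (auto simp: ell1_def dilation_def)
qed

text \<open>Equality is allowed in the domination hypothesis, so the maximum estimate alone is no
  contradiction. It forces every gap \<open>?b k * M - ?b k * ?z k\<close> to vanish; as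
  \<open>?z k < M\<close>, all \<open>a (k + 2)\<close> are zero, and then
  \<open>cmod (a 1) * M \<le> 0\<close>.\<close>

lemma czero_annihilator_trivial:
  assumes a: "a \<in> ell1" "a 1 \<noteq> 0" "suminf (\<lambda>k. cmod (a (k + 2))) \<le> cmod (a 1)"
    and y: "y \<in> czero"
    and ann: "\<And>n. n \<ge> 1 \<Longrightarrow> pairing (dilation n a) y = 0"
  shows "y = 0"
proof (rule ccontr)
  assume "y \<noteq> 0"
  then obtain m where m: "y m \<noteq> 0" by (auto simp: fun_eq_iff)
  \<comment> \<open>\<open>G\<close> holds every index that can compete for the maximum and is
    finite because \<open>y\<close> tends to 0.\<close>
  define G where "G = {n. cmod (y m) \<le> cmod (y n)}"
  have "(\<lambda>n. cmod (y n)) \<longlonglongrightarrow> 0" using y by (simp add: czero_def tendsto_norm_zero)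
  hence "eventually (\<lambda>n. cmod (y n) < cmod (y m)) sequentially"
    using m by (intro order_tendstoD(2)) auto
  then obtain n0 where "\<And>n. n \<ge> n0 \<Longrightarrow> cmod (y n) < cmod (y m)"
    by (auto simp: eventually_sequentially)
  hence "G \<subseteq> {..<n0}" by (force simp: G_def not_less[symmetric])
  hence fin: "finite G" using finite_subset by blast
  have mG: "m \<in> G" by (simp add: G_def)
  define M where "M = Max ((\<lambda>n. cmod (y n)) ` G)"
  have M: "cmod (y n) \<le> M" if "n \<in> G" for n
    using that fin by (simp add: M_def)
  have M_all: "cmod (y n) \<le> M" for n
    using M[of n] M[OF mG] by (cases "n \<in> G") (auto simp: G_def)
  have Mpos: "M > 0" using M[OF mG] m by (smt (verit) zero_less_norm_iff)
  define H where "H = {n\<in>G. cmod (y n) = M}"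
  have "M \<in> (\<lambda>n. cmod (y n)) ` G" unfolding M_def using fin mG by (intro Max_in) auto
  hence H: "H \<noteq> {}" "finite H" using fin by (auto simp: H_def)
  \<comment> \<open>The last maximizing index is taken so that its proper multiples lie outside
    \<open>H\<close>.\<close>
  define n where "n = Max H"
  have n: "cmod (y n) = M" using Max_in[OF H(2,1)] by (simp add: n_def H_def)
  have n1: "n \<ge> 1" using n Mpos y by (cases n) (auto simp: czero_def)
  have less: "cmod (y (n * (k + 2))) < M" for k
  proof -
    have "n < n * (k + 2)" using n1 by simp
    hence "n * (k + 2) \<notin> H" using Max_ge[OF H(2)] unfolding n_def by (meson not_less)
    moreover have "cmod (y (n * (k + 2))) = M \<Longrightarrow> n * (k + 2) \<in> H"
      using M[OF mG] by (simp add: H_def G_def)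
    ultimately show ?thesis using M_all[of "n * (k + 2)"] by fastforce
  qed
  let ?b = "\<lambda>k. cmod (a (k + 2))" and ?z = "\<lambda>k. cmod (y (n * (k + 2)))"
  have b: "summable ?b" using a(1) summable_ignore_initial_segment[of "\<lambda>n. cmod (a n)" 2]
    by (simp add: ell1_def)
  have bM: "summable (\<lambda>k. ?b k * M)" by (rule summable_mult2[OF b])
  have bz: "summable (\<lambda>k. ?b k * ?z k)"
    by (rule summable_comparison_test'[OF bM]) (use M_all in \<open>auto intro: mult_left_mono\<close>)
  have sz: "summable (\<lambda>k. a (k + 2) * y (n * (k + 2)))"
    by (rule summable_norm_cancel) (use bz in \<open>simp add: norm_mult\<close>)
  hence s: "summable (\<lambda>k. a k * y (n * k))"
    by (subst summable_iff_shift[symmetric, of _ 2]) simp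
  have "0 = suminf (\<lambda>k. a k * y (n * k))" using ann[OF n1] pairing_dilation[OF n1] by simp
  \<comment> \<open>The terms with indices 0 and 1 are split off; the former is zero because
    \<open>a 0 = 0\<close>.\<close>
  also have "\<dots> = suminf (\<lambda>k. a (k + 2) * y (n * (k + 2))) + a 1 * y n"
    using suminf_split_initial_segment[OF s, of 2] a(1) by (simp add: numeral_2_eq_2 ell1_def)
  finally have "a 1 * y n = - suminf (\<lambda>k. a (k + 2) * y (n * (k + 2)))"
    by (simp add: eq_neg_iff_add_eq_0 add.commute)
  hence "cmod (a 1) * M = cmod (suminf (\<lambda>k. a (k + 2) * y (n * (k + 2))))"
    using n by (metis norm_minus_cancel norm_mult)
  also have "\<dots> \<le> suminf (\<lambda>k. ?b k * ?z k)"
    using summable_norm[of "\<lambda>k. a (k + 2) * y (n * (k + 2))"] bz by (simp add: norm_mult)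
  finally have le: "cmod (a 1) * M \<le> suminf (\<lambda>k. ?b k * ?z k)" .
  have "suminf (\<lambda>k. ?b k * M) \<le> cmod (a 1) * M"
    unfolding suminf_mult2[OF b, symmetric] using a(3) Mpos by (intro mult_right_mono) auto
  \<comment> \<open>Nonnegative gaps with sum at most 0 must all be zero.\<close>
  with le have "suminf (\<lambda>k. ?b k * M - ?b k * ?z k) \<le> 0"
    using suminf_diff[OF bM bz] by simp
  moreover have nn: "0 \<le> ?b k * M - ?b k * ?z k" for k
    using M_all by (simp add: mult_left_mono)
  moreover have sd: "summable (\<lambda>k. ?b k * M - ?b k * ?z k)" by (rule summable_diff[OF bM bz])
  ultimately have "suminf (\<lambda>k. ?b k * M - ?b k * ?z k) = 0"
    using suminf_nonneg[OF sd nn] by linarith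
  hence "\<And>k. ?b k * M - ?b k * ?z k = 0" using suminf_eq_zero_iff[OF sd nn] by blast
  hence "?b k = 0" for k using less[of k] by (metis eq_iff_diff_eq_0 less_irrefl mult_cancel_left)
  hence "suminf (\<lambda>k. ?b k * ?z k) = 0" by simp
  thus False using le a(2) Mpos by (simp add: mult_le_0_iff)
qed

text \<open>Common criterion for both claims: it serves with \<open>Y = dual_space X\<close> for a
  lattice and with \<open>Y = czero\<close> for \<open>X = ell1\<close>.\<close>

lemma dilation_cyclic_weak_topology:
  assumes X: "seq.subspace X" "a \<in> X" "\<And>n. n \<ge> 1 \<Longrightarrow> dilation n a \<in> X"
    and Y: "seq.subspace Y" "Y \<subseteq> dual_space X" "Y \<subseteq> czero"
    and a: "a \<in> ell1" "a 1 \<noteq> 0" "suminf (\<lambda>k. cmod (a (k + 2))) \<le> cmod (a 1)"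
  shows "dilation_cyclic (weak_topology X Y) a"
proof -
  let ?S = "seq.span {dilation n a |n. n \<ge> 1}"
  have "weak_topology X Y closure_of ?S = X"
  proof (rule weak_topology_closure_of_subspace[OF X(1) seq.subspace_span _ Y(1,2)])
    show "?S \<subseteq> X" using X by (intro seq.span_minimal) auto
    fix y assume "y \<in> Y" and ann: "\<And>s. s \<in> ?S \<Longrightarrow> pairing s y = 0"
    show "y = 0"
      by (rule czero_annihilator_trivial[OF a])
        (use \<open>y \<in> Y\<close> Y(3) in \<open>auto intro!: ann seq.span_base\<close>)
  qed
  moreover have "topspace (weak_topology X Y) = X"
    using seq.subspace_0[OF Y(1)] by (intro topspace_weak_topology) auto
  ultimately show ?thesis using X(2) by (simp add: dilation_cyclic_def)
qed

section \<open>The dual of an invariant sequence lattice\<close>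

context banach_sequence_space
begin

section \<open>Absolutely convergent series\<close>

lemma norm_minus_commute: "x \<in> X \<Longrightarrow> y \<in> X \<Longrightarrow> N (x - y) = N (y - x)"
  using norm_scale[of "y - x" "-1"] seq.subspace_diff[OF subspace, of y x]
  by (simp add: fun_diff_def)

lemma norm_sum_le:
  "finite I \<Longrightarrow> (\<And>i. i \<in> I \<Longrightarrow> v i \<in> X) \<Longrightarrow> N (sum v I) \<le> (\<Sum>i\<in>I. N (v i))"
proof (induction I rule: finite_induct)
  case empty
  show ?case using norm_eq_zero[of 0] seq.subspace_0[OF subspace] by (simp add: zero_fun_def)
next
  case (insert i I)
  have "sum v I \<in> X" using insert.prems by (intro seq.subspace_sum[OF subspace]) auto
  hence "N (v i + sum v I) \<le> N (v i) + N (sum v I)" using insert.prems by (intro norm_triangle) auto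
  moreover have "N (sum v I) \<le> (\<Sum>i\<in>I. N (v i))" using insert.prems by (intro insert.IH) auto
  ultimately show ?case unfolding sum.insert[OF insert.hyps] by linarith
qed

lemma absolutely_convergent:
  assumes v: "\<And>i. v i \<in> X" and s: "summable (\<lambda>i. N (v i))"
  obtains x where "x \<in> X" "(\<lambda>m. N ((\<Sum>i<m. v i) - x)) \<longlonglongrightarrow> 0"
proof -
  let ?S = "\<lambda>m. \<Sum>i<m. v i"
  have SX: "?S m \<in> X" for m using v by (intro seq.subspace_sum[OF subspace]) auto
  have "\<exists>M. \<forall>i\<ge>M. \<forall>j\<ge>M. N (?S i - ?S j) < e" if e: "e > 0" for e
  proof -
    obtain M where M: "\<And>i j. i \<ge> M \<Longrightarrow> norm (\<Sum>k=i..<j. N (v k)) < e"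
      using s e unfolding summable_Cauchy by blast
    have *: "N (?S j - ?S i) < e" if "M \<le> i" "i \<le> j" for i j
    proof -
      have "?S j - ?S i = sum v {i..<j}"
        using that(2) by (simp add: lessThan_atLeast0 sum_diff_nat_ivl)
      thus ?thesis using norm_sum_le[of "{i..<j}" v] v M[OF that(1), of j] by simp
    qed
    have "N (?S i - ?S j) < e" if "M \<le> i" "M \<le> j" for i j
      using *[of i j] *[of j i] that norm_minus_commute[OF SX SX] by (cases "i \<le> j") auto
    thus ?thesis by blast
  qed
  thus ?thesis using complete[of ?S] SX that by blast
qed

end

context invariant_sequence_lattice
begin

lemma unit_seq_mem: "n \<ge> 1 \<Longrightarrow> unit_seq n \<in> X"
  using dilation_closed[OF _ unit_seq_1, of n] dilation_unit_seq[of n 1] by simp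

lemma norm_unit_seq_pos:
  assumes "n \<ge> 1"
  shows "N (unit_seq n) > 0"
proof -
  have "unit_seq n \<noteq> 0" by (auto simp: unit_seq_def fun_eq_iff)
  thus ?thesis using norm_nonneg norm_eq_zero unit_seq_mem[OF assms] by fastforce
qed

text \<open>The sequence reduced to its \<open>n\<close>-th entry is dominated by \<open>x\<close>,
  so solidity applies. Coordinates are therefore norm continuous.\<close>

lemma coordinate_le:
  assumes "x \<in> X" "n \<ge> 1"
  shows "cmod (x n) * N (unit_seq n) \<le> N x"
proof -
  have "N (\<lambda>k. x n * unit_seq n k) \<le> N x"
    using assms by (intro conjunct2[OF solid]) (auto simp: unit_seq_def)
  thus ?thesis using norm_scale[OF unit_seq_mem[OF assms(2)]] by simp
qed

lemma coordinate_tendsto: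
  assumes "\<And>m. u m \<in> X" "x \<in> X" "(\<lambda>m. N (u m - x)) \<longlonglongrightarrow> 0"
  shows "(\<lambda>m. u m n) \<longlonglongrightarrow> x n"
proof (cases "n = 0")
  case True
  thus ?thesis using index_zero[OF assms(1)] index_zero[OF assms(2)] by simp
next
  case False
  hence n: "n \<ge> 1" by simp
  have "(\<lambda>m. u m n - x n) \<longlonglongrightarrow> 0"
  proof (rule Lim_null_comparison)
    show "(\<lambda>m. N (u m - x) / N (unit_seq n)) \<longlonglongrightarrow> 0"
      using assms(3) by (rule tendsto_divide_zero)
    show "\<forall>\<^sub>F m in sequentially. norm (u m n - x n) \<le> N (u m - x) / N (unit_seq n)"
      using coordinate_le[OF seq.subspace_diff[OF subspace assms(1,2)] n] norm_unit_seq_pos[OF n]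
      by (simp add: pos_le_divide_eq)
  qed
  thus ?thesis by (simp add: LIM_zero_iff)
qed

text \<open>Were the set unbounded, elements \<open>u i\<close> of the unit ball with pairings above
  \<open>4 ^ i\<close> could be summed, with weights \<open>(1/2) ^ i\<close> and moduli in place of
  entries, to an \<open>x\<close> in \<open>X\<close> whose series against \<open>y\<close> exceeds
  every \<open>2 ^ i\<close>. Boundedness is what makes the real supremum in
  \<open>dual_norm\<close> an upper bound.\<close>

lemma bdd_above_pairing_unit_ball:
  assumes y: "y \<in> dual_space X"
  shows "bdd_above ((\<lambda>x. cmod (pairing x y)) ` {x\<in>X. N x \<le> 1})"
proof (rule ccontr)
  assume "\<not> ?thesis"
  hence "\<forall>i::nat. \<exists>x\<in>X. N x \<le> 1 \<and> cmod (pairing x y) > 4 ^ i"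
    unfolding bdd_above_def by (auto simp: not_le)
  then obtain u where u: "\<And>i. u i \<in> X" "\<And>i. N (u i) \<le> 1" "\<And>i. cmod (pairing (u i) y) > 4 ^ i"
    by metis
  \<comment> \<open>Passing to moduli rules out cancellation in the sum; solidity keeps them in
    \<open>X\<close>.\<close>
  define v where "v = (\<lambda>i n. complex_of_real ((1/2) ^ i * cmod (u i n)))"
  have v: "v i \<in> X \<and> N (v i) \<le> (1/2) ^ i" for i
  proof -
    have "(\<lambda>n. (1/2) ^ i * u i n) \<in> X"
      using seq.subspace_scale[OF subspace u(1)] by simp
    hence "v i \<in> X \<and> N (v i) \<le> N (\<lambda>n. (1/2) ^ i * u i n)"
      by (rule solid) (auto simp: v_def index_zero[OF u(1)] norm_mult norm_power)
    moreover have "N (\<lambda>n. (1/2) ^ i * u i n) \<le> (1/2) ^ i"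
      using norm_scale[OF u(1), of "(1/2) ^ i" i] u(2)[of i]
      by (simp add: norm_power norm_divide mult_left_le)
    ultimately show ?thesis by linarith
  qed
  have "summable (\<lambda>i. N (v i))"
    by (rule summable_comparison_test'[of "\<lambda>i. (1/2) ^ i"]) (use v norm_nonneg in auto)
  then obtain x where x: "x \<in> X" "(\<lambda>m. N ((\<Sum>i<m. v i) - x)) \<longlonglongrightarrow> 0"
    using absolutely_convergent[of v] v by blast
  \<comment> \<open>The norm limit is also the coordinatewise limit, so \<open>x\<close> dominates
    each single summand.\<close>
  have ge: "(1/2) ^ i * cmod (u i n) \<le> cmod (x n)" for i n
  proof -
    have "(\<lambda>m. (\<Sum>i<m. v i) n) \<longlonglongrightarrow> x n"
      by (rule coordinate_tendsto[OF _ x]) (use v in \<open>auto intro: seq.subspace_sum[OF subspace]\<close>)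
    hence lim: "(\<lambda>m. cmod ((\<Sum>i<m. v i) n)) \<longlonglongrightarrow> cmod (x n)" by (rule tendsto_norm)
    have "(1/2) ^ i * cmod (u i n) \<le> cmod ((\<Sum>i<m. v i) n)" if "m > i" for m
    proof -
      have "(\<Sum>i<m. v i) n = (\<Sum>i<m. v i n)"
        by (induction m) auto
      also have "\<dots> = complex_of_real (\<Sum>i<m. (1/2) ^ i * cmod (u i n))"
        by (simp add: v_def)
      finally have "cmod ((\<Sum>i<m. v i) n) = (\<Sum>i<m. (1/2) ^ i * cmod (u i n))"
        by (simp only: norm_of_real) (simp add: sum_nonneg)
      moreover have "(1/2) ^ i * cmod (u i n) \<le> (\<Sum>i<m. (1/2) ^ i * cmod (u i n))"
        using that by (intro member_le_sum[where f = "\<lambda>i. (1/2) ^ i * cmod (u i n)"]) auto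
      ultimately show ?thesis by simp
    qed
    thus ?thesis by (intro LIMSEQ_le_const[OF lim]) (auto intro!: exI[of _ "Suc i"])
  qed
  define T where "T = suminf (\<lambda>n. cmod (x n * y n))"
  have "2 ^ i \<le> T" for i :: nat
  proof -
    have su: "summable (\<lambda>n. cmod (u i n * y n))" by (rule dual_space_summable(1)[OF y u(1)])
    have "(1/2) ^ i * 4 ^ i \<le> (1/2) ^ i * cmod (pairing (u i) y)"
      using u(3)[of i] by (intro mult_left_mono) auto
    also have "\<dots> \<le> (1/2) ^ i * suminf (\<lambda>n. cmod (u i n * y n))"
      using summable_norm[OF su] by (intro mult_left_mono) (auto simp: pairing_def)
    also have "\<dots> = suminf (\<lambda>n. (1/2) ^ i * cmod (u i n * y n))"
      by (rule suminf_mult[OF su, symmetric])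
    also have "\<dots> \<le> T" unfolding T_def
    proof (intro suminf_le summable_mult su dual_space_summable(1)[OF y x(1)])
      show "(1/2) ^ i * cmod (u i n * y n) \<le> cmod (x n * y n)" for n
        using mult_right_mono[OF ge[of i n], of "cmod (y n)"] by (simp add: norm_mult)
    qed
    also have "(1/2) ^ i * 4 ^ i = (2 :: real) ^ i"
      by (simp add: power_mult_distrib[symmetric])
    finally show ?thesis .
  qed
  thus False using real_arch_pow[of 2 T] by (auto simp: not_less[symmetric])
qed

text \<open>If the norms were unbounded, weights \<open>(1/2) ^ i\<close> placed at indices
  \<open>k i\<close> with \<open>N (unit_seq (k i)) > 4 ^ i\<close> would give an element of
  \<open>ell1\<close>, hence of \<open>X\<close>, whose norm exceeds every \<open>2 ^ i\<close> by
  \<open>coordinate_le\<close>.\<close>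

lemma norm_unit_seq_bounded:
  assumes "ell1 \<subseteq> X"
  obtains C where "\<And>n. n \<ge> 1 \<Longrightarrow> N (unit_seq n) \<le> C"
proof (rule ccontr)
  assume "\<not> thesis"
  hence unb: "\<exists>n\<ge>1. N (unit_seq n) > C" for C using that by (meson not_le)
  have "\<exists>k. \<forall>i. (4 ^ i < N (unit_seq (k i)) \<and> k i \<ge> 1) \<and> k i < k (Suc i)"
  proof (rule dependent_nat_choice)
    show "\<exists>n. 4 ^ 0 < N (unit_seq n) \<and> n \<ge> 1" using unb by auto
    fix m i :: nat
    \<comment> \<open>Adding the norms of the first \<open>m\<close> unit vectors to the bound
      forces \<open>n > m\<close>, so the chosen indices increase strictly.\<close>
    obtain n where n: "n \<ge> 1" "N (unit_seq n) > 4 ^ Suc i + (\<Sum>j\<in>{1..m}. N (unit_seq j))"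
      using unb by blast
    have sub: "0 \<le> N (unit_seq j)" if "j \<in> {1..m}" for j
      using norm_nonneg[OF unit_seq_mem] that by auto
    have "m < n"
    proof (rule ccontr)
      assume "\<not> m < n"
      hence "N (unit_seq n) \<le> (\<Sum>j\<in>{1..m}. N (unit_seq j))"
        using n(1) sub by (intro member_le_sum[where f = "\<lambda>j. N (unit_seq j)"]) auto
      moreover have "(0::real) < 4 ^ Suc i" by simp
      ultimately show False using n(2) by linarith
    qed
    moreover have "0 \<le> (\<Sum>j\<in>{1..m}. N (unit_seq j))" by (rule sum_nonneg[OF sub])
    hence "4 ^ Suc i < N (unit_seq n)" using n(2) by linarith
    ultimately show "\<exists>n. (4 ^ Suc i < N (unit_seq n) \<and> n \<ge> 1) \<and> m < n" using n(1) by blast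
  qed
  then obtain k where k: "\<And>i. 4 ^ i < N (unit_seq (k i))" "\<And>i. k i \<ge> 1" "strict_mono k"
    by (auto simp: strict_mono_Suc_iff)
  have inj: "inj k" using k(3) strict_mono_imp_inj_on by blast
  define x where "x = (\<lambda>n. if n \<in> range k then complex_of_real ((1/2) ^ inv k n) else 0)"
  have xk: "x (k i) = of_real ((1/2) ^ i)" for i using inj by (simp add: x_def)
  have "summable (\<lambda>i. cmod (x (k i))) \<longleftrightarrow> summable (\<lambda>n. cmod (x n))"
    by (rule summable_mono_reindex[OF k(3)]) (auto simp: x_def)
  moreover have "summable (\<lambda>i. cmod (x (k i)))"
    unfolding xk norm_of_real by (simp add: summable_geometric)
  moreover have "0 \<notin> range k" using k(2) by (metis not_one_le_zero rangeE)
  ultimately have "x \<in> ell1" by (auto simp: ell1_def x_def)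
  hence xX: "x \<in> X" using assms by blast
  have "2 ^ i \<le> N x" for i :: nat
  proof -
    have "(2::real) ^ i = (1/2) ^ i * 4 ^ i" by (simp add: power_mult_distrib[symmetric])
    also have "\<dots> \<le> (1/2) ^ i * N (unit_seq (k i))"
      using k(1)[of i] by (intro mult_left_mono) auto
    also have "\<dots> = cmod (x (k i)) * N (unit_seq (k i))"
      unfolding xk norm_of_real by simp
    also have "\<dots> \<le> N x" by (rule coordinate_le[OF xX k(2)])
    finally show ?thesis .
  qed
  thus False using real_arch_pow[of 2 "N x"] by (auto simp: not_less[symmetric])
qed

text \<open>Test \<open>y\<close> against the \<open>n\<close>-th unit vector scaled to norm
  one.\<close>

lemma dual_coordinate_le:
  assumes y: "y \<in> dual_space X" and n: "n \<ge> 1"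
  shows "cmod (y n) \<le> N (unit_seq n) * dual_norm X N y"
proof -
  define c where "c = N (unit_seq n)"
  have c: "c > 0" unfolding c_def by (rule norm_unit_seq_pos[OF n])
  let ?x = "\<lambda>k. complex_of_real (1 / c) * unit_seq n k"
  have xX: "?x \<in> X" by (rule seq.subspace_scale[OF subspace unit_seq_mem[OF n]])
  have "N ?x \<le> 1"
    using norm_scale[OF unit_seq_mem[OF n], of "complex_of_real (1 / c)"] c
    by (simp add: c_def norm_divide)
  hence "cmod (pairing ?x y) \<le> dual_norm X N y"
    unfolding dual_norm_def using xX by (intro cSUP_upper bdd_above_pairing_unit_ball[OF y]) simp
  moreover have "pairing (unit_seq n) y = y n"
    using suminf_finite[of "{n}" "\<lambda>k. unit_seq n k * y k"] by (simp add: pairing_def unit_seq_def)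
  ultimately have "cmod (y n) / c \<le> dual_norm X N y"
    using pairing_scale_left[OF y unit_seq_mem[OF n], of "of_real (1 / c)"] c
    by (simp add: norm_mult norm_divide)
  thus ?thesis using c by (simp add: pos_divide_le_eq mult.commute c_def)
qed

lemma dual_space_subset_czero:
  assumes "ell1 \<subseteq> X" and dense: "finitely_supported_dense (dual_space X) (dual_norm X N)"
  shows "dual_space X \<subseteq> czero"
proof
  fix y assume y: "y \<in> dual_space X"
  obtain C where C: "\<And>n. n \<ge> 1 \<Longrightarrow> N (unit_seq n) \<le> C"
    using norm_unit_seq_bounded[OF assms(1)] by blast
  have Cpos: "C > 0" using norm_unit_seq_pos[of 1] C[of 1] by simp
  have "y \<longlonglongrightarrow> 0"
  proof (rule LIMSEQ_I)
    fix e :: real assume e: "e > 0"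
    \<comment> \<open>The tolerance \<open>e / C\<close> absorbs the factor
      \<open>N (unit_seq n) \<le> C\<close> in \<open>dual_coordinate_le\<close>.\<close>
    obtain z where z: "z \<in> dual_space X" "finite {n. z n \<noteq> 0}" "dual_norm X N (y - z) < e / C"
      using dense y e Cpos unfolding finitely_supported_dense_def by (meson divide_pos_pos)
    obtain m where m: "\<And>n. z n \<noteq> 0 \<Longrightarrow> n < m"
      using z(2) by (metis (mono_tags) finite_nat_set_iff_bounded mem_Collect_eq)
    have "norm (y n - 0) < e" if n: "n \<ge> Suc m" for n
    proof -
      have d: "cmod ((y - z) n) \<le> N (unit_seq n) * dual_norm X N (y - z)"
        using n by (intro dual_coordinate_le seq.subspace_diff[OF subspace_dual_space] y z) auto
      have pos: "N (unit_seq n) > 0" "N (unit_seq n) \<le> C" using norm_unit_seq_pos C n by auto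
      have "N (unit_seq n) * dual_norm X N (y - z) < N (unit_seq n) * (e / C)"
        by (rule mult_strict_left_mono[OF z(3) pos(1)])
      also have "\<dots> \<le> C * (e / C)" using pos(2) e Cpos by (intro mult_right_mono) auto
      finally have "cmod ((y - z) n) < e" using d Cpos by simp
      moreover have "z n = 0" using m[of n] n by fastforce
      ultimately show ?thesis by simp
    qed
    thus "\<exists>n0. \<forall>n\<ge>n0. norm (y n - 0) < e" by blast
  qed
  thus "y \<in> czero" using y by (simp add: czero_def dual_space_def)
qed

end

section \<open>Power series with dominating free term\<close>

lemma index_nat_0: "index_nat 0 = 1"
  by (simp add: index_nat_def)

text \<open>\<open>index_nat\<close> sends the zero multi-index to 1 and the others bijectively onto
  \<open>{2..}\<close>. The free term thus becomes the entry at 1, and the sum over nonzero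
  multi-indices becomes the series shifted by 2.\<close>

lemma coeff_seq_dominated:
  assumes "f \<noteq> 0" "free_term_dominates f"
  shows "coeff_seq f \<in> ell1" "coeff_seq f 1 \<noteq> 0"
    "suminf (\<lambda>k. cmod (coeff_seq f (k + 2))) \<le> cmod (coeff_seq f 1)"
proof -
  let ?a = "\<lambda>n. cmod (coeff_seq f n)"
  have sum: "(\<lambda>\<alpha>. cmod (f \<alpha>)) summable_on {\<alpha>. \<alpha> \<noteq> 0}"
    and le: "(\<Sum>\<^sub>\<infinity>\<alpha>\<in>{\<alpha>. \<alpha> \<noteq> 0}. cmod (f \<alpha>)) \<le> cmod (f 0)"
    using assms(2) by (auto simp: free_term_dominates_def)
  have inj: "inj index_nat" and ran: "range index_nat = {1..}"
    using bij_betw_index_nat by (auto simp: bij_betw_def)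
  have "index_nat ` {\<alpha>. \<alpha> \<noteq> 0} = {1..} - {1}"
    using image_set_diff[OF inj, of UNIV "{0}"] ran index_nat_0 by (simp add: Compl_eq_Diff_UNIV[symmetric] Collect_neg_eq)
  hence "index_nat ` {\<alpha>. \<alpha> \<noteq> 0} = {2..}" by auto
  hence bij1: "bij_betw index_nat {\<alpha>. \<alpha> \<noteq> 0} {2..}"
    using inj by (auto simp: bij_betw_def intro: inj_on_subset)
  have "bij_betw (\<lambda>k::nat. k + 2) UNIV {2..}"
    by (rule bij_betw_byWitness[where f' = "\<lambda>k. k - 2"]) auto
  note bij2 = this
  have "?a summable_on {2..}"
    using summable_on_reindex_bij_betw[OF bij1, of ?a] sum by (simp add: coeff_seq_index_nat)
  hence so: "(\<lambda>k. ?a (k + 2)) summable_on UNIV"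
    using summable_on_reindex_bij_betw[OF bij2, of ?a] by simp
  hence su: "summable (\<lambda>k. ?a (k + 2))" by (rule summable_on_imp_summable)
  hence "summable ?a" by (subst (asm) summable_iff_shift)
  thus "coeff_seq f \<in> ell1" by (simp add: ell1_def coeff_seq_def)
  have a1: "coeff_seq f 1 = f 0" using coeff_seq_index_nat[of f 0] index_nat_0 by simp
  have "suminf (\<lambda>k. ?a (k + 2)) = infsum (\<lambda>k. ?a (k + 2)) UNIV"
    using has_sum_imp_sums[OF has_sum_infsum[OF so]] sums_unique by metis
  also have "\<dots> = infsum ?a {2..}"
    by (rule infsum_reindex_bij_betw[OF bij2])
  also have "\<dots> = infsum (\<lambda>\<alpha>. cmod (f \<alpha>)) {\<alpha>. \<alpha> \<noteq> 0}"
    using infsum_reindex_bij_betw[OF bij1, of ?a] by (simp add: coeff_seq_index_nat)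
  finally show "suminf (\<lambda>k. ?a (k + 2)) \<le> cmod (coeff_seq f 1)" using le a1 by simp
  \<comment> \<open>A vanishing free term would dominate only the zero series.\<close>
  show "coeff_seq f 1 \<noteq> 0"
  proof
    assume "coeff_seq f 1 = 0"
    hence f0: "f 0 = 0" using a1 by simp
    have "f \<alpha> = 0" if "\<alpha> \<noteq> 0" for \<alpha>
      using nonneg_infsum_le_0D[of "\<lambda>\<alpha>. cmod (f \<alpha>)" "{\<alpha>. \<alpha> \<noteq> 0}" \<alpha>] le f0 sum that by simp
    hence "f = 0" using f0 by (metis ext zero_fun_apply)
    thus False using assms(1) by simp
  qed
qed

text \<open>For a polynomial the infinite sum has only finitely many nonzero terms.\<close>

lemma free_term_dominates_lookup:
  assumes "(\<Sum>\<alpha>\<in>Poly_Mapping.keys p - {0}. cmod (Poly_Mapping.lookup p \<alpha>)) \<le> cmod (Poly_Mapping.lookup p 0)"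
  shows "free_term_dominates (Poly_Mapping.lookup p)"
proof -
  have "((\<lambda>\<alpha>. cmod (Poly_Mapping.lookup p \<alpha>)) has_sum
      (\<Sum>\<alpha>\<in>Poly_Mapping.keys p - {0}. cmod (Poly_Mapping.lookup p \<alpha>))) {\<alpha>. \<alpha> \<noteq> 0}"
    by (rule has_sum_finite_neutralI) (auto simp: in_keys_iff)
  thus ?thesis using assms
    by (auto simp: free_term_dominates_def has_sum_imp_summable dest: infsumI)
qed

lemma dilation_cyclic_dominated:
  assumes "f \<noteq> 0" "free_term_dominates f"
  shows "invariant_sequence_lattice X N \<Longrightarrow> ell1 \<subseteq> X \<Longrightarrow>
      finitely_supported_dense (dual_space X) (dual_norm X N) \<Longrightarrow>
      dilation_cyclic (weak_topology X (dual_space X)) (coeff_seq f)"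
    and "dilation_cyclic (weak_topology ell1 czero) (coeff_seq f)"
proof -
  note a = coeff_seq_dominated[OF assms]
  show "dilation_cyclic (weak_topology ell1 czero) (coeff_seq f)"
    by (rule dilation_cyclic_weak_topology)
      (simp_all add: a[simplified] subspace_ell1 subspace_czero dilation_ell1 czero_subset_dual_space_ell1)
  assume "invariant_sequence_lattice X N" and X: "ell1 \<subseteq> X"
    and dense: "finitely_supported_dense (dual_space X) (dual_norm X N)"
  then interpret invariant_sequence_lattice X N by blast
  have "coeff_seq f \<in> X" using a(1) X by blast
  thus "dilation_cyclic (weak_topology X (dual_space X)) (coeff_seq f)"
    using a by (intro dilation_cyclic_weak_topology subspace subspace_dual_space
        dual_space_subset_czero[OF X dense] dilation_closed) auto
qed

theorem proposition6p5:
  shows "(\<forall>f :: (nat \<Rightarrow>\<^sub>0 nat) \<Rightarrow> complex. f \<noteq> 0 \<longrightarrow> free_term_dominates f \<longrightarrow>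
      (\<forall>X N. invariant_sequence_lattice X N \<longrightarrow> ell1 \<subseteq> X \<longrightarrow>
        finitely_supported_dense (dual_space X) (dual_norm X N) \<longrightarrow>
        dilation_cyclic (weak_topology X (dual_space X)) (coeff_seq f)) \<and>
      dilation_cyclic (weak_topology ell1 czero) (coeff_seq f))
    \<and> (\<forall>p :: (nat \<Rightarrow>\<^sub>0 nat) \<Rightarrow>\<^sub>0 complex. p \<noteq> 0 \<longrightarrow>
      cmod (Poly_Mapping.lookup p 0) \<ge> (\<Sum>\<alpha>\<in>Poly_Mapping.keys p - {0}. cmod (Poly_Mapping.lookup p \<alpha>)) \<longrightarrow>
      (\<forall>X N. invariant_sequence_lattice X N \<longrightarrow> ell1 \<subseteq> X \<longrightarrow>
        finitely_supported_dense (dual_space X) (dual_norm X N) \<longrightarrow>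
        dilation_cyclic (weak_topology X (dual_space X)) (coeff_seq (Poly_Mapping.lookup p))) \<and>
      dilation_cyclic (weak_topology ell1 czero) (coeff_seq (Poly_Mapping.lookup p)))"
proof (intro conjI allI impI)
  fix p :: "(nat \<Rightarrow>\<^sub>0 nat) \<Rightarrow>\<^sub>0 complex"
  assume p: "p \<noteq> 0"
    and le: "cmod (Poly_Mapping.lookup p 0) \<ge>
      (\<Sum>\<alpha>\<in>Poly_Mapping.keys p - {0}. cmod (Poly_Mapping.lookup p \<alpha>))"
  have "Poly_Mapping.lookup p \<noteq> 0" using p by (auto simp: poly_mapping_eq_iff fun_eq_iff)
  note dom = dilation_cyclic_dominated[OF this free_term_dominates_lookup[OF le]]
  show "dilation_cyclic (weak_topology ell1 czero) (coeff_seq (Poly_Mapping.lookup p))"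
    by (rule dom(2))
  show "dilation_cyclic (weak_topology X (dual_space X)) (coeff_seq (Poly_Mapping.lookup p))"
    if "invariant_sequence_lattice X N" "ell1 \<subseteq> X"
      "finitely_supported_dense (dual_space X) (dual_norm X N)" for X N
    by (rule dom(1)[OF that])
qed (rule dilation_cyclic_dominated; assumption)+

end
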